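(* Let $G\neq\{1\}$ be a group that decomposes as an extension $$1\longrightarrow K\longrightarrow G\overset{\pi}{\longrightarrow}Q\longrightarrow 1,$$ with coupling $\Theta:Q\to \mathrm{Out}(K)$, and let $\Phi:FC(Q)\to \mathrm{Out}(K)$ denote the restriction of $\Theta$ to $FC(Q)$. Then $G$ is icc if and only if both of the following conditions hold: (i) $FC_G(K)=\{1\}$; (ii) $\ker\Phi$ does not contain an element $q\neq 1$ such that $[q]=0$ in $H^1(C(q),Z)$.
   Context: A group is icc if it is infinite and all of its conjugacy classes except $\{1\}$ are infinite. Write ${}^{y}x=yxy^{-1}$. For a normal subgroup $K$ of $G$ (in an extension, $K$ is identified with its image in $G$), $FC_G(K)=\{u\in K:\ \text{the } G\text{-conjugacy class of } u \text{ is finite}\}$; $FC(Q)=FC_Q(Q)$ is the union of all finite conjugacy classes of $Q$. The coupling $\Theta:Q\to\mathrm{Out}(K)$ sends $q$ to the class of the automorphism $x\mapsto gxg^{-1}$ of $K$, for any $g\in\pi^{-1}(q)$. $Z=Z(K)$ is the center of $K$ and $C(q)=C_Q(q)$ is the centralizer of $q$ in $Q$. The class $[q]$: choose a set-theoretic section $q\mapsto\overline{q}$ of $\pi$. The group $Q$ acts on $Z$ by $u\cdot z={}^{\overline u}z$ (independent of the section). For $q\in\ker\Theta$ choose $k\in K$ with $\overline q\,x\,\overline q^{-1}=kxk^{-1}$ for all $x\in K$. For $u\in C(q)$ let $\delta_q(u)\in K$ be defined by $\overline u\,\overline q\,\overline u^{-1}=\overline q\,\delta_q(u)$, and put $d_q(u)=\delta_q(u)^{-1}k^{-1}\,({}^{\overline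 u}k)$. Then $d_q(u)\in Z$, the map $d_q:C(q)\to Z$ is a 1-cocycle, and its class $[q]\in H^1(C(q),Z)$ does not depend on the choices of the section and of $k$. Here $H^1(C(q),Z)$ is the quotient of the abelian group (under pointwise multiplication) of maps $f:C(q)\to Z$ with $f(uv)=f(u)\,({}^{\overline u}f(v))$ for all $u,v$, by the subgroup of maps of the form $u\mapsto z^{-1}\,({}^{\overline u}z)$ with $z\in Z$; $0$ denotes its trivial class. *)

theory Defs
  imports "HOL-Algebra.Algebra"
begin

section \<open>Conjugacy classes and the icc property\<close>

definition conj_by :: "('a, 'm) monoid_scheme \<Rightarrow> 'a \<Rightarrow> 'a \<Rightarrow> 'a" where
  "conj_by G y x = y \<otimes>\<^bsub>G\<^esub> x \<otimes>\<^bsub>G\<^esub> inv\<^bsub>G\<^esub> y"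

definition conj_class :: "('a, 'm) monoid_scheme \<Rightarrow> 'a \<Rightarrow> 'a set" where
  "conj_class G x = {conj_by G y x |y. y \<in> carrier G}"

definition icc :: "('a, 'm) monoid_scheme \<Rightarrow> bool" where
  "icc G \<longleftrightarrow> infinite (carrier G) \<and>
     (\<forall>x\<in>carrier G. x \<noteq> \<one>\<^bsub>G\<^esub> \<longrightarrow> infinite (conj_class G x))"

definition FC_in :: "('a, 'm) monoid_scheme \<Rightarrow> 'a set \<Rightarrow> 'a set" where
  "FC_in G K = {u \<in> K. finite (conj_class G u)}"

definition FC :: "('a, 'm) monoid_scheme \<Rightarrow> 'a set" where
  "FC Q = FC_in Q (carrier Q)"

definition centralizer :: "('a, 'm) monoid_scheme \<Rightarrow> 'a \<Rightarrow> 'a set" where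
  "centralizer G x = {y \<in> carrier G. y \<otimes>\<^bsub>G\<^esub> x = x \<otimes>\<^bsub>G\<^esub> y}"

definition center :: "('a, 'm) monoid_scheme \<Rightarrow> 'a set" where
  "center G = {z \<in> carrier G. \<forall>x\<in>carrier G. z \<otimes>\<^bsub>G\<^esub> x = x \<otimes>\<^bsub>G\<^esub> z}"


section \<open>Outer automorphisms\<close>

definition inner_auts :: "('a, 'm) monoid_scheme \<Rightarrow> ('a \<Rightarrow> 'a) set" where
  "inner_auts K = {restrict (conj_by K k) (carrier K) |k. k \<in> carrier K}"

definition Out :: "('a, 'm) monoid_scheme \<Rightarrow> ('a \<Rightarrow> 'a) set monoid" where
  "Out K = AutoGroup K Mod inner_auts K"


section \<open>First cohomology of a group with coefficients in a module\<close>

text \<open>The group \<open>C\<close> acts on the abelian group \<open>A\<close> (written multiplicatively) through \<open>act\<close>.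
  Maps \<open>C \<rightarrow> A\<close> are represented by extensional functions on the carrier.\<close>

definition cocycles1 ::
  "('c, 'm) monoid_scheme \<Rightarrow> ('a, 'n) monoid_scheme \<Rightarrow> ('c \<Rightarrow> 'a \<Rightarrow> 'a) \<Rightarrow> ('c \<Rightarrow> 'a) monoid" where
  "cocycles1 C A act =
     \<lparr>carrier = {f \<in> carrier C \<rightarrow>\<^sub>E carrier A. \<forall>u\<in>carrier C. \<forall>v\<in>carrier C.
                   f (u \<otimes>\<^bsub>C\<^esub> v) = f u \<otimes>\<^bsub>A\<^esub> act u (f v)},
      monoid.mult = (\<lambda>f g. \<lambda>u\<in>carrier C. f u \<otimes>\<^bsub>A\<^esub> g u),
      monoid.one = (\<lambda>u\<in>carrier C. \<one>\<^bsub>A\<^esub>)\<rparr>"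

definition coboundaries1 ::
  "('c, 'm) monoid_scheme \<Rightarrow> ('a, 'n) monoid_scheme \<Rightarrow> ('c \<Rightarrow> 'a \<Rightarrow> 'a) \<Rightarrow> ('c \<Rightarrow> 'a) set" where
  "coboundaries1 C A act = {\<lambda>u\<in>carrier C. inv\<^bsub>A\<^esub> z \<otimes>\<^bsub>A\<^esub> act u z |z. z \<in> carrier A}"

definition H1 ::
  "('c, 'm) monoid_scheme \<Rightarrow> ('a, 'n) monoid_scheme \<Rightarrow> ('c \<Rightarrow> 'a \<Rightarrow> 'a) \<Rightarrow> ('c \<Rightarrow> 'a) set monoid" where
  "H1 C A act = cocycles1 C A act Mod coboundaries1 C A act"


section \<open>Group extensions\<close>

locale group_extension = K: group K + G: group G + Q: group Q
  for K :: "('k, 'l) monoid_scheme" and G :: "('g, 'm) monoid_scheme"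
    and Q :: "('q, 'n) monoid_scheme" and \<iota> :: "'k \<Rightarrow> 'g" and \<pi> :: "'g \<Rightarrow> 'q" +
  assumes inj: "\<iota> \<in> mon K G"
    and surj: "\<pi> \<in> epi G Q"
    and exact: "\<iota> ` carrier K = kernel G Q \<pi>"

text \<open>From here on the kernel group is identified with its image in \<open>G\<close>: the argument \<open>K\<close> of
  the following definitions is a (normal) subset of the carrier of \<open>G\<close>.  The definite
  descriptions express that the value does not depend on the choices; that they are well
  defined for every extension is proved in \<open>coupling_eq\<close>, \<open>coeff_act_eq\<close>,
  \<open>ext_choices_exist\<close> and \<open>ext_class_eq\<close> below.\<close>

definition coupling ::
  "('g, 'm) monoid_scheme \<Rightarrow> 'g set \<Rightarrow> ('g \<Rightarrow> 'q) \<Rightarrow> 'q \<Rightarrow> ('g \<Rightarrow> 'g) set" where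
  "coupling G K \<pi> q =
     (THE c. \<exists>g\<in>carrier G. \<pi> g = q \<and>
        c = inner_auts (G\<lparr>carrier := K\<rparr>) #>\<^bsub>AutoGroup (G\<lparr>carrier := K\<rparr>)\<^esub> restrict (conj_by G g) K)"

definition coeff_group :: "('g, 'm) monoid_scheme \<Rightarrow> 'g set \<Rightarrow> ('g, 'm) monoid_scheme" where
  "coeff_group G K = G\<lparr>carrier := center (G\<lparr>carrier := K\<rparr>)\<rparr>"

definition coeff_act ::
  "('g, 'm) monoid_scheme \<Rightarrow> ('g \<Rightarrow> 'q) \<Rightarrow> 'q \<Rightarrow> 'g \<Rightarrow> 'g" where
  "coeff_act G \<pi> u z = (THE w. \<exists>g\<in>carrier G. \<pi> g = u \<and> w = conj_by G g z)"

definition centralizer_group :: "('q, 'n) monoid_scheme \<Rightarrow> 'q \<Rightarrow> ('q, 'n) monoid_scheme" where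
  "centralizer_group Q q = Q\<lparr>carrier := centralizer Q q\<rparr>"

abbreviation H1_centralizer ::
  "('g, 'm) monoid_scheme \<Rightarrow> 'g set \<Rightarrow> ('q, 'n) monoid_scheme \<Rightarrow> ('g \<Rightarrow> 'q) \<Rightarrow> 'q
     \<Rightarrow> ('q \<Rightarrow> 'g) set monoid" where
  "H1_centralizer G K Q \<pi> q \<equiv>
     H1 (centralizer_group Q q) (coeff_group G K) (coeff_act G \<pi>)"

definition set_section ::
  "('g, 'm) monoid_scheme \<Rightarrow> ('q, 'n) monoid_scheme \<Rightarrow> ('g \<Rightarrow> 'q) \<Rightarrow> ('q \<Rightarrow> 'g) \<Rightarrow> bool" where
  "set_section G Q \<pi> s \<longleftrightarrow> (\<forall>q\<in>carrier Q. s q \<in> carrier G \<and> \<pi> (s q) = q)"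

definition implements_conj ::
  "('g, 'm) monoid_scheme \<Rightarrow> 'g set \<Rightarrow> 'g \<Rightarrow> 'g \<Rightarrow> bool" where
  "implements_conj G K g k \<longleftrightarrow> k \<in> K \<and> (\<forall>x\<in>K. conj_by G g x = conj_by G k x)"

text \<open>\<open>\<delta>\<^sub>q(u)\<close> is the solution of \<open>s(u) s(q) s(u)\<^sup>-\<^sup>1 = s(q) \<delta>\<^sub>q(u)\<close>.\<close>

definition ext_delta ::
  "('g, 'm) monoid_scheme \<Rightarrow> ('q \<Rightarrow> 'g) \<Rightarrow> 'q \<Rightarrow> 'q \<Rightarrow> 'g" where
  "ext_delta G s q u = inv\<^bsub>G\<^esub> (s q) \<otimes>\<^bsub>G\<^esub> conj_by G (s u) (s q)"

definition ext_cocycle ::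
  "('g, 'm) monoid_scheme \<Rightarrow> ('q, 'n) monoid_scheme \<Rightarrow> ('q \<Rightarrow> 'g) \<Rightarrow> 'q \<Rightarrow> 'g \<Rightarrow> 'q \<Rightarrow> 'g" where
  "ext_cocycle G Q s q k =
     (\<lambda>u\<in>centralizer Q q.
        inv\<^bsub>G\<^esub> (ext_delta G s q u) \<otimes>\<^bsub>G\<^esub> inv\<^bsub>G\<^esub> k \<otimes>\<^bsub>G\<^esub> conj_by G (s u) k)"

text \<open>The class \<open>[q] \<in> H\<^sup>1(C(q), Z)\<close>, as a coset of the coboundaries; meaningful for \<open>q\<close> in the kernel of the coupling.\<close>

definition ext_class ::
  "('g, 'm) monoid_scheme \<Rightarrow> 'g set \<Rightarrow> ('q, 'n) monoid_scheme \<Rightarrow> ('g \<Rightarrow> 'q) \<Rightarrow> 'q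
     \<Rightarrow> ('q \<Rightarrow> 'g) set" where
  "ext_class G K Q \<pi> q =
     (THE c. \<exists>s k. set_section G Q \<pi> s \<and> implements_conj G K (s q) k \<and>
        c = coboundaries1 (centralizer_group Q q) (coeff_group G K) (coeff_act G \<pi>)
              #>\<^bsub>cocycles1 (centralizer_group Q q) (coeff_group G K) (coeff_act G \<pi>)\<^esub>
              ext_cocycle G Q s q k)"


section \<open>The choices made above do not matter\<close>

context group
begin

lemma inv_cancel_left [simp]:
  "x \<in> carrier G \<Longrightarrow> y \<in> carrier G \<Longrightarrow> inv x \<otimes> (x \<otimes> y) = y"
  "x \<in> carrier G \<Longrightarrow> y \<in> carrier G \<Longrightarrow> x \<otimes> (inv x \<otimes> y) = y"
  by (simp_all flip: m_assoc)

lemma conj_by_closed [simp]: "g \<in> carrier G \<Longrightarrow> x \<in> carrier G \<Longrightarrow> conj_by G g x \<in> carrier G"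
  by (simp add: conj_by_def)

lemma conj_by_mult:
  "\<lbrakk>g \<in> carrier G; x \<in> carrier G; y \<in> carrier G\<rbrakk>
    \<Longrightarrow> conj_by G g (x \<otimes> y) = conj_by G g x \<otimes> conj_by G g y"
  by (simp add: conj_by_def m_assoc)

lemma conj_by_conj_by:
  "\<lbrakk>g \<in> carrier G; h \<in> carrier G; x \<in> carrier G\<rbrakk>
    \<Longrightarrow> conj_by G (g \<otimes> h) x = conj_by G g (conj_by G h x)"
  by (simp add: conj_by_def m_assoc inv_mult_group)

lemma conj_by_inv:
  "\<lbrakk>g \<in> carrier G; x \<in> carrier G\<rbrakk> \<Longrightarrow> conj_by G g (inv x) = inv (conj_by G g x)"
  by (simp add: conj_by_def m_assoc inv_mult_group)

lemma conj_by_eq_self: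
  "\<lbrakk>g \<in> carrier G; x \<in> carrier G; g \<otimes> x = x \<otimes> g\<rbrakk> \<Longrightarrow> conj_by G g x = x"
  by (simp add: conj_by_def m_assoc)

lemma conj_by_one [simp]: "x \<in> carrier G \<Longrightarrow> conj_by G \<one> x = x"
  by (simp add: conj_by_def)

lemma conj_by_inv_cancel [simp]:
  "\<lbrakk>g \<in> carrier G; x \<in> carrier G\<rbrakk> \<Longrightarrow> conj_by G g (conj_by G (inv g) x) = x"
  "\<lbrakk>g \<in> carrier G; x \<in> carrier G\<rbrakk> \<Longrightarrow> conj_by G (inv g) (conj_by G g x) = x"
  by (simp_all flip: conj_by_conj_by)

end

lemma (in normal) conj_by_in: "\<lbrakk>g \<in> carrier G; x \<in> H\<rbrakk> \<Longrightarrow> conj_by G g x \<in> H"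
  unfolding conj_by_def by (rule inv_op_closed2)

lemma (in normal) conj_by_auto:
  assumes g: "g \<in> carrier G"
  shows "restrict (conj_by G g) H \<in> carrier (AutoGroup (G\<lparr>carrier := H\<rparr>))"
proof -
  have "bij_betw (conj_by G g) H H"
    by (rule bij_betwI[where g = "conj_by G (inv g)"]) (use g in \<open>auto intro: conj_by_in\<close>)
  then have "restrict (conj_by G g) H \<in> Bij H"
    by (auto simp: Bij_def cong: bij_betw_cong)
  moreover have "restrict (conj_by G g) H \<in> hom (G\<lparr>carrier := H\<rparr>) (G\<lparr>carrier := H\<rparr>)"
    using g by (auto simp: hom_def conj_by_in conj_by_mult)
  ultimately show ?thesis
    by (simp add: AutoGroup_def auto_def)
qed

lemma (in normal) conj_by_comp:
  assumes "g \<in> carrier G" "h \<in> carrier G"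
  shows "restrict (conj_by G g) H \<otimes>\<^bsub>AutoGroup (G\<lparr>carrier := H\<rparr>)\<^esub> restrict (conj_by G h) H
       = restrict (conj_by G (g \<otimes> h)) H"
  using conj_by_auto[OF assms(1)] conj_by_auto[OF assms(2)] assms
  by (auto simp: AutoGroup_def BijGroup_def auto_def compose_def conj_by_conj_by conj_by_in
           intro!: restrict_ext)

lemma (in normal) inner_auts_eq:
  "inner_auts (G\<lparr>carrier := H\<rparr>) = {restrict (conj_by G k) H |k. k \<in> H}"
proof -
  have "conj_by (G\<lparr>carrier := H\<rparr>) k = conj_by G k" if "k \<in> H" for k
    using that subgroup_axioms by (auto simp: conj_by_def)
  then show ?thesis
    by (force simp: inner_auts_def)
qed

lemma (in normal) subgroup_inner_auts:
  "subgroup (inner_auts (G\<lparr>carrier := H\<rparr>)) (AutoGroup (G\<lparr>carrier := H\<rparr>))"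
proof -
  interpret A: group "AutoGroup (G\<lparr>carrier := H\<rparr>)"
    by (rule group.AutoGroup[OF subgroup_is_group[OF is_group]])
  have one: "\<one>\<^bsub>AutoGroup (G\<lparr>carrier := H\<rparr>)\<^esub> = restrict (conj_by G \<one>) H"
    by (auto simp: AutoGroup_def BijGroup_def)
  show ?thesis
  proof (rule A.subgroupI)
    show "inner_auts (G\<lparr>carrier := H\<rparr>) \<subseteq> carrier (AutoGroup (G\<lparr>carrier := H\<rparr>))"
      by (auto simp: inner_auts_eq intro: conj_by_auto)
    have "restrict (conj_by G \<one>) H \<in> inner_auts (G\<lparr>carrier := H\<rparr>)"
      unfolding inner_auts_eq by (rule CollectI, rule exI[of _ "\<one>"]) simp
    then show "inner_auts (G\<lparr>carrier := H\<rparr>) \<noteq> {}" by auto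
  next
    fix a assume "a \<in> inner_auts (G\<lparr>carrier := H\<rparr>)"
    then obtain k where k: "k \<in> H" "a = restrict (conj_by G k) H"
      by (auto simp: inner_auts_eq)
    have "inv\<^bsub>AutoGroup (G\<lparr>carrier := H\<rparr>)\<^esub> a = restrict (conj_by G (inv k)) H"
      using k by (intro A.inv_equality) (auto simp: conj_by_comp one intro!: conj_by_auto)
    then show "inv\<^bsub>AutoGroup (G\<lparr>carrier := H\<rparr>)\<^esub> a \<in> inner_auts (G\<lparr>carrier := H\<rparr>)"
      using k by (auto simp: inner_auts_eq)
  next
    fix a b assume "a \<in> inner_auts (G\<lparr>carrier := H\<rparr>)" "b \<in> inner_auts (G\<lparr>carrier := H\<rparr>)"
    then show "a \<otimes>\<^bsub>AutoGroup (G\<lparr>carrier := H\<rparr>)\<^esub> b \<in> inner_auts (G\<lparr>carrier := H\<rparr>)"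
      unfolding inner_auts_eq using conj_by_comp[OF mem_carrier mem_carrier] m_closed by blast
  qed
qed

locale group_module = C: group C + A: comm_group A
  for C :: "('c, 'm) monoid_scheme" and A :: "('a, 'n) monoid_scheme"
    and act :: "'c \<Rightarrow> 'a \<Rightarrow> 'a" +
  assumes act_closed: "\<lbrakk>u \<in> carrier C; a \<in> carrier A\<rbrakk> \<Longrightarrow> act u a \<in> carrier A"
    and act_mult: "\<lbrakk>u \<in> carrier C; a \<in> carrier A; b \<in> carrier A\<rbrakk>
                     \<Longrightarrow> act u (a \<otimes>\<^bsub>A\<^esub> b) = act u a \<otimes>\<^bsub>A\<^esub> act u b"
    and act_act: "\<lbrakk>u \<in> carrier C; v \<in> carrier C; a \<in> carrier A\<rbrakk>
                     \<Longrightarrow> act (u \<otimes>\<^bsub>C\<^esub> v) a = act u (act v a)"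
begin

lemma act_one: "u \<in> carrier C \<Longrightarrow> act u \<one>\<^bsub>A\<^esub> = \<one>\<^bsub>A\<^esub>"
  by (metis A.l_cancel_one' A.one_closed A.r_one act_closed act_mult)

lemma act_inv:
  "\<lbrakk>u \<in> carrier C; a \<in> carrier A\<rbrakk> \<Longrightarrow> act u (inv\<^bsub>A\<^esub> a) = inv\<^bsub>A\<^esub> (act u a)"
  by (metis A.inv_closed A.inv_equality A.l_inv act_closed act_mult act_one)

lemma comm_group_cocycles1: "comm_group (cocycles1 C A act)"
proof (rule comm_groupI)
  fix f assume f: "f \<in> carrier (cocycles1 C A act)"
  then have [simp]: "f u \<in> carrier A" if "u \<in> carrier C" for u
    using that by (auto simp: cocycles1_def)
  show "\<exists>g\<in>carrier (cocycles1 C A act). g \<otimes>\<^bsub>cocycles1 C A act\<^esub> f = \<one>\<^bsub>cocycles1 C A act\<^esub>"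
    by (rule bexI[of _ "\<lambda>u\<in>carrier C. inv\<^bsub>A\<^esub> (f u)"])
       (use f in \<open>auto simp: cocycles1_def act_inv act_closed A.inv_mult A.l_inv
                       intro!: restrict_ext\<close>)
next
  fix f g assume "f \<in> carrier (cocycles1 C A act)" "g \<in> carrier (cocycles1 C A act)"
  note fg = this
  have [simp]: "f u \<in> carrier A" "g u \<in> carrier A" if "u \<in> carrier C" for u
    using that fg by (auto simp: cocycles1_def)
  show "f \<otimes>\<^bsub>cocycles1 C A act\<^esub> g \<in> carrier (cocycles1 C A act)"
    using fg by (auto simp: cocycles1_def act_closed act_mult A.m_ac)
  show "f \<otimes>\<^bsub>cocycles1 C A act\<^esub> g = g \<otimes>\<^bsub>cocycles1 C A act\<^esub> f"
    by (auto simp: cocycles1_def A.m_comm intro!: restrict_ext)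
  fix h assume h: "h \<in> carrier (cocycles1 C A act)"
  have [simp]: "h u \<in> carrier A" if "u \<in> carrier C" for u
    using that h by (auto simp: cocycles1_def)
  show "f \<otimes>\<^bsub>cocycles1 C A act\<^esub> g \<otimes>\<^bsub>cocycles1 C A act\<^esub> h
      = f \<otimes>\<^bsub>cocycles1 C A act\<^esub> (g \<otimes>\<^bsub>cocycles1 C A act\<^esub> h)"
    by (auto simp: cocycles1_def A.m_assoc intro!: restrict_ext)
next
  fix f assume f: "f \<in> carrier (cocycles1 C A act)"
  then have [simp]: "f u \<in> carrier A" if "u \<in> carrier C" for u
    using that by (auto simp: cocycles1_def)
  have "f \<in> extensional (carrier C)" using f by (auto simp: cocycles1_def PiE_def)
  then show "\<one>\<^bsub>cocycles1 C A act\<^esub> \<otimes>\<^bsub>cocycles1 C A act\<^esub> f = f"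
    by (auto simp: cocycles1_def fun_eq_iff extensional_def)
qed (auto simp: cocycles1_def act_one)

lemma subgroup_coboundaries1: "subgroup (coboundaries1 C A act) (cocycles1 C A act)"
proof -
  interpret Z: comm_group "cocycles1 C A act" by (rule comm_group_cocycles1)
  let ?b = "\<lambda>z. \<lambda>u\<in>carrier C. inv\<^bsub>A\<^esub> z \<otimes>\<^bsub>A\<^esub> act u z"
  have b: "?b z \<in> carrier (cocycles1 C A act)" if z: "z \<in> carrier A" for z
    using z by (auto simp: cocycles1_def act_closed act_mult act_act act_inv A.m_assoc)
  have bm: "?b z \<otimes>\<^bsub>cocycles1 C A act\<^esub> ?b w = ?b (z \<otimes>\<^bsub>A\<^esub> w)"
    if "z \<in> carrier A" "w \<in> carrier A" for z w
    using that by (auto simp: cocycles1_def act_closed act_mult A.inv_mult A.m_ac intro!: restrict_ext)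
  have b1: "?b \<one>\<^bsub>A\<^esub> = \<one>\<^bsub>cocycles1 C A act\<^esub>"
    by (auto simp: cocycles1_def act_one intro!: restrict_ext)
  have bi: "inv\<^bsub>cocycles1 C A act\<^esub> ?b z = ?b (inv\<^bsub>A\<^esub> z)" if z: "z \<in> carrier A" for z
    using bm[of "inv\<^bsub>A\<^esub> z" z] b[OF z] b[of "inv\<^bsub>A\<^esub> z"] b1 z
    by (intro Z.inv_equality) (simp_all only: A.l_inv A.inv_closed)
  show ?thesis
  proof (rule Z.subgroupI)
    show "coboundaries1 C A act \<subseteq> carrier (cocycles1 C A act)"
      using b by (auto simp: coboundaries1_def)
    show "coboundaries1 C A act \<noteq> {}"
      by (auto simp: coboundaries1_def)
  next
    fix f assume "f \<in> coboundaries1 C A act"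
    then show "inv\<^bsub>cocycles1 C A act\<^esub> f \<in> coboundaries1 C A act"
      using bi unfolding coboundaries1_def by clarify (metis A.inv_closed)
  next
    fix f g assume "f \<in> coboundaries1 C A act" "g \<in> coboundaries1 C A act"
    then show "f \<otimes>\<^bsub>cocycles1 C A act\<^esub> g \<in> coboundaries1 C A act"
      using bm unfolding coboundaries1_def by clarify (metis A.m_closed)
  qed
qed

lemma comm_group_H1: "comm_group (H1 C A act)"
  unfolding H1_def
  by (rule comm_group.abelian_FactGroup[OF comm_group_cocycles1 subgroup_coboundaries1])

end

locale kernel_extension = G: group G + Q: group Q
  for G :: "('g, 'm) monoid_scheme" and Q :: "('q, 'n) monoid_scheme" +
  fixes \<pi> :: "'g \<Rightarrow> 'q" and N :: "'g set"
  assumes surj: "\<pi> \<in> epi G Q"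
    and N_eq: "N = kernel G Q \<pi>"
begin

sublocale hom: group_hom G Q \<pi>
  using surj unfolding epi_def
  by (intro group_hom.intro group_hom_axioms.intro G.is_group Q.is_group) blast

sublocale N: normal N G
  unfolding N_eq by (rule hom.normal_kernel)

lemma N_I: "x \<in> carrier G \<Longrightarrow> \<pi> x = \<one>\<^bsub>Q\<^esub> \<Longrightarrow> x \<in> N"
  unfolding N_eq kernel_def by blast

lemma N_D: "x \<in> N \<Longrightarrow> \<pi> x = \<one>\<^bsub>Q\<^esub>"
  unfolding N_eq kernel_def by blast

lemma lift_exists:
  assumes "q \<in> carrier Q"
  shows "\<exists>g\<in>carrier G. \<pi> g = q"
proof -
  have "\<pi> ` carrier G = carrier Q" using surj unfolding epi_def by blast
  then have "q \<in> \<pi> ` carrier G" using assms by (rule ssubst)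
  then show ?thesis by (elim imageE) (rule bexI, rule sym)
qed

lemma same_fibre:
  assumes "g \<in> carrier G" "h \<in> carrier G" "\<pi> g = \<pi> h"
  shows "\<exists>k\<in>N. g = k \<otimes>\<^bsub>G\<^esub> h" "\<exists>k\<in>N. g = h \<otimes>\<^bsub>G\<^esub> k"
proof -
  show "\<exists>k\<in>N. g = k \<otimes>\<^bsub>G\<^esub> h"
    using assms by (intro bexI[of _ "g \<otimes>\<^bsub>G\<^esub> inv\<^bsub>G\<^esub> h"]) (auto simp: G.m_assoc intro!: N_I)
  show "\<exists>k\<in>N. g = h \<otimes>\<^bsub>G\<^esub> k"
    using assms by (intro bexI[of _ "inv\<^bsub>G\<^esub> h \<otimes>\<^bsub>G\<^esub> g"]) (auto simp: G.m_assoc intro!: N_I)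
qed

abbreviation autN where "autN \<equiv> AutoGroup (G\<lparr>carrier := N\<rparr>)"
abbreviation innN where "innN \<equiv> inner_auts (G\<lparr>carrier := N\<rparr>)"
abbreviation conjN where "conjN g \<equiv> restrict (conj_by G g) N"

lemma group_autN: "group autN"
  by (rule group.AutoGroup[OF N.subgroup_is_group[OF G.is_group]])

theorem coupling_eq:
  assumes g: "g \<in> carrier G"
  shows "coupling G N \<pi> (\<pi> g) = innN #>\<^bsub>autN\<^esub> conjN g"
  unfolding coupling_def
proof (rule the_equality)
  show "\<exists>h\<in>carrier G. \<pi> h = \<pi> g \<and> innN #>\<^bsub>autN\<^esub> conjN g = innN #>\<^bsub>autN\<^esub> conjN h"
    using g by blast
next
  fix c assume "\<exists>h\<in>carrier G. \<pi> h = \<pi> g \<and> c = innN #>\<^bsub>autN\<^esub> conjN h"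
  then obtain h where h: "h \<in> carrier G" "\<pi> h = \<pi> g" and c: "c = innN #>\<^bsub>autN\<^esub> conjN h"
    by blast
  from same_fibre(1)[OF h(1) g h(2)] obtain k where k: "k \<in> N" "h = k \<otimes>\<^bsub>G\<^esub> g" by blast
  have "conjN h = conjN k \<otimes>\<^bsub>autN\<^esub> conjN g"
    using k g by (simp add: N.conj_by_comp)
  moreover have "conjN k \<in> innN" using k by (auto simp: N.inner_auts_eq)
  ultimately have "conjN h \<in> innN #>\<^bsub>autN\<^esub> conjN g" by (auto simp: r_coset_def)
  then show "c = innN #>\<^bsub>autN\<^esub> conjN g"
    using group.repr_independence[OF group_autN _ N.conj_by_auto[OF g] N.subgroup_inner_auts] c
    by simp
qed

lemma coupling_one_iff:
  assumes g: "g \<in> carrier G"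
  shows "coupling G N \<pi> (\<pi> g) = \<one>\<^bsub>Out (G\<lparr>carrier := N\<rparr>)\<^esub> \<longleftrightarrow> (\<exists>k. implements_conj G N g k)"
proof -
  have "coupling G N \<pi> (\<pi> g) = \<one>\<^bsub>Out (G\<lparr>carrier := N\<rparr>)\<^esub> \<longleftrightarrow> innN #>\<^bsub>autN\<^esub> conjN g = innN"
    by (simp add: coupling_eq[OF g] Out_def)
  also have "\<dots> \<longleftrightarrow> conjN g \<in> innN"
    using group.coset_join1[OF group_autN _ N.conj_by_auto[OF g] N.subgroup_inner_auts]
      group.coset_join2[OF group_autN N.conj_by_auto[OF g] N.subgroup_inner_auts] by blast
  also have "\<dots> \<longleftrightarrow> (\<exists>k. implements_conj G N g k)"
    by (auto simp: N.inner_auts_eq implements_conj_def fun_eq_iff restrict_def)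
  finally show ?thesis .
qed

definition centralizes :: "'g \<Rightarrow> bool" where
  "centralizes c \<longleftrightarrow> c \<in> carrier G \<and> (\<forall>x\<in>N. conj_by G c x = x)"

lemma centralizes_closed: "centralizes c \<Longrightarrow> c \<in> carrier G"
  by (simp add: centralizes_def)

lemma conj_by_eq_iff:
  assumes "c \<in> carrier G" "x \<in> carrier G"
  shows "conj_by G c x = x \<longleftrightarrow> c \<otimes>\<^bsub>G\<^esub> x = x \<otimes>\<^bsub>G\<^esub> c"
  unfolding conj_by_def using assms G.inv_solve_right'[of x "c \<otimes>\<^bsub>G\<^esub> x" c] by auto

lemma centralizes_commute:
  assumes "centralizes c" "x \<in> N"
  shows "c \<otimes>\<^bsub>G\<^esub> x = x \<otimes>\<^bsub>G\<^esub> c"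
  using assms conj_by_eq_iff[of c x] N.mem_carrier[of x] by (simp add: centralizes_def)

lemma centralizes_one: "centralizes \<one>\<^bsub>G\<^esub>"
  by (simp add: centralizes_def N.mem_carrier)

lemma centralizes_inv:
  assumes c: "centralizes c" shows "centralizes (inv\<^bsub>G\<^esub> c)"
  unfolding centralizes_def
proof (intro conjI ballI)
  show "inv\<^bsub>G\<^esub> c \<in> carrier G" using c by (simp add: centralizes_def)
  fix x assume x: "x \<in> N"
  then have "conj_by G (inv\<^bsub>G\<^esub> c) x = conj_by G (inv\<^bsub>G\<^esub> c) (conj_by G c x)"
    using c unfolding centralizes_def by metis
  also have "\<dots> = x"
    by (rule G.conj_by_inv_cancel(2)[OF centralizes_closed[OF c] N.mem_carrier[OF x]])
  finally show "conj_by G (inv\<^bsub>G\<^esub> c) x = x" .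
qed

lemma centralizes_mult: "centralizes c \<Longrightarrow> centralizes d \<Longrightarrow> centralizes (c \<otimes>\<^bsub>G\<^esub> d)"
  by (simp add: centralizes_def G.conj_by_conj_by N.mem_carrier)

lemma centralizes_conj:
  assumes c: "centralizes c" and g: "g \<in> carrier G"
  shows "centralizes (conj_by G g c)"
  unfolding centralizes_def
proof (intro conjI ballI)
  have cc: "c \<in> carrier G" using c by (rule centralizes_closed)
  show "conj_by G g c \<in> carrier G" using cc g by simp
  fix x assume x: "x \<in> N"
  have y: "conj_by G (inv\<^bsub>G\<^esub> g) x \<in> N" using g x by (simp add: N.conj_by_in)
  have "conj_by G (conj_by G g c) x = conj_by G g (conj_by G c (conj_by G (inv\<^bsub>G\<^esub> g) x))"
    using g cc N.mem_carrier[OF x] by (simp add: conj_by_def G.m_assoc G.inv_mult_group)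
  also have "\<dots> = x"
    using c y g N.mem_carrier[OF x] by (simp add: centralizes_def)
  finally show "conj_by G (conj_by G g c) x = x" .
qed

abbreviation Z where "Z \<equiv> center (G\<lparr>carrier := N\<rparr>)"

lemma Z_iff: "z \<in> Z \<longleftrightarrow> z \<in> N \<and> centralizes z"
  using N.mem_carrier by (auto simp: center_def centralizes_def conj_by_eq_iff)

lemma Z_carrier: "z \<in> Z \<Longrightarrow> z \<in> carrier G"
  by (auto simp: Z_iff dest: N.mem_carrier)

lemma conj_by_Z: "g \<in> carrier G \<Longrightarrow> z \<in> Z \<Longrightarrow> conj_by G g z \<in> Z"
  by (simp add: Z_iff N.conj_by_in centralizes_conj)

lemma subgroup_Z: "subgroup Z G"
proof (rule G.subgroupI)
  have "\<one>\<^bsub>G\<^esub> \<in> Z" by (simp add: Z_iff centralizes_one N.one_closed)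
  then show "Z \<noteq> {}" by blast
qed (use Z_carrier in \<open>auto simp: Z_iff centralizes_inv centralizes_mult\<close>)

lemma Z_commute: "z \<in> Z \<Longrightarrow> w \<in> Z \<Longrightarrow> z \<otimes>\<^bsub>G\<^esub> w = w \<otimes>\<^bsub>G\<^esub> z"
  by (auto simp: Z_iff intro: centralizes_commute)

lemma carrier_coeff [simp]: "carrier (coeff_group G N) = Z"
  and mult_coeff [simp]: "x \<otimes>\<^bsub>coeff_group G N\<^esub> y = x \<otimes>\<^bsub>G\<^esub> y"
  by (simp_all add: coeff_group_def)

lemma comm_group_coeff: "comm_group (coeff_group G N)"
proof -
  interpret A: group "coeff_group G N"
    unfolding coeff_group_def by (rule subgroup.subgroup_is_group[OF subgroup_Z G.is_group])
  show ?thesis by (rule A.group_comm_groupI) (use Z_commute in auto)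
qed

lemma inv_coeff: "z \<in> Z \<Longrightarrow> inv\<^bsub>coeff_group G N\<^esub> z = inv\<^bsub>G\<^esub> z"
  by (simp add: coeff_group_def G.m_inv_consistent[OF subgroup_Z])

theorem coeff_act_eq:
  assumes g: "g \<in> carrier G" and z: "z \<in> Z"
  shows "coeff_act G \<pi> (\<pi> g) z = conj_by G g z"
  unfolding coeff_act_def
proof (rule the_equality)
  show "\<exists>h\<in>carrier G. \<pi> h = \<pi> g \<and> conj_by G g z = conj_by G h z" using g by blast
next
  fix w assume "\<exists>h\<in>carrier G. \<pi> h = \<pi> g \<and> w = conj_by G h z"
  then obtain h where h: "h \<in> carrier G" "\<pi> h = \<pi> g" and w: "w = conj_by G h z" by blast
  from same_fibre(2)[OF h(1) g h(2)] obtain k where k: "k \<in> N" "h = g \<otimes>\<^bsub>G\<^esub> k" by blast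
  have "conj_by G k z = z"
    using centralizes_commute[of z k] k z N.mem_carrier Z_carrier
    by (intro G.conj_by_eq_self) (auto simp: Z_iff)
  then show "w = conj_by G g z"
    using w k g z Z_carrier N.mem_carrier by (simp add: G.conj_by_conj_by)
qed

lemma centralizer_carrier: "u \<in> centralizer Q q \<Longrightarrow> u \<in> carrier Q"
  by (simp add: centralizer_def)

lemma subgroup_centralizer:
  assumes q: "q \<in> carrier Q"
  shows "subgroup (centralizer Q q) Q"
proof (rule Q.subgroupI)
  show "centralizer Q q \<subseteq> carrier Q" by (auto simp: centralizer_def)
  have "\<one>\<^bsub>Q\<^esub> \<in> centralizer Q q" using q by (simp add: centralizer_def)
  then show "centralizer Q q \<noteq> {}" by blast
next
  fix u assume u: "u \<in> centralizer Q q"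
  then have e: "q \<otimes>\<^bsub>Q\<^esub> u = u \<otimes>\<^bsub>Q\<^esub> q" and c: "u \<in> carrier Q" by (auto simp: centralizer_def)
  have "inv\<^bsub>Q\<^esub> u \<otimes>\<^bsub>Q\<^esub> q = inv\<^bsub>Q\<^esub> u \<otimes>\<^bsub>Q\<^esub> (q \<otimes>\<^bsub>Q\<^esub> u) \<otimes>\<^bsub>Q\<^esub> inv\<^bsub>Q\<^esub> u"
    using c q by (simp add: Q.m_assoc)
  also have "\<dots> = q \<otimes>\<^bsub>Q\<^esub> inv\<^bsub>Q\<^esub> u"
    unfolding e using c q by (simp add: Q.m_assoc)
  finally show "inv\<^bsub>Q\<^esub> u \<in> centralizer Q q"
    using c by (simp add: centralizer_def)
next
  fix u v assume "u \<in> centralizer Q q" "v \<in> centralizer Q q"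
  then have c: "u \<in> carrier Q" "v \<in> carrier Q"
    and e: "u \<otimes>\<^bsub>Q\<^esub> q = q \<otimes>\<^bsub>Q\<^esub> u" "v \<otimes>\<^bsub>Q\<^esub> q = q \<otimes>\<^bsub>Q\<^esub> v"
    by (auto simp: centralizer_def)
  have "u \<otimes>\<^bsub>Q\<^esub> v \<otimes>\<^bsub>Q\<^esub> q = u \<otimes>\<^bsub>Q\<^esub> q \<otimes>\<^bsub>Q\<^esub> v"
    using c q by (simp only: Q.m_assoc e(2))
  also have "\<dots> = q \<otimes>\<^bsub>Q\<^esub> (u \<otimes>\<^bsub>Q\<^esub> v)"
    unfolding e(1) using c q by (simp only: Q.m_assoc)
  finally show "u \<otimes>\<^bsub>Q\<^esub> v \<in> centralizer Q q"
    using c by (simp add: centralizer_def)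
qed

lemma carrier_centralizer_group [simp]: "carrier (centralizer_group Q q) = centralizer Q q"
  and mult_centralizer_group [simp]: "x \<otimes>\<^bsub>centralizer_group Q q\<^esub> y = x \<otimes>\<^bsub>Q\<^esub> y"
  by (simp_all add: centralizer_group_def)

theorem group_module_centralizer:
  assumes q: "q \<in> carrier Q"
  shows "group_module (centralizer_group Q q) (coeff_group G N) (coeff_act G \<pi>)"
proof -
  interpret C: group "centralizer_group Q q"
    unfolding centralizer_group_def
    by (rule subgroup.subgroup_is_group[OF subgroup_centralizer[OF q] Q.is_group])
  interpret A: comm_group "coeff_group G N" by (rule comm_group_coeff)
  have lift: "\<exists>g\<in>carrier G. \<pi> g = u" if "u \<in> centralizer Q q" for u
    using that by (intro lift_exists) (rule centralizer_carrier)
  show ?thesis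
  proof unfold_locales
    fix u a assume "u \<in> carrier (centralizer_group Q q)" "a \<in> carrier (coeff_group G N)"
    then show "coeff_act G \<pi> u a \<in> carrier (coeff_group G N)"
      using lift[of u] by (auto simp: coeff_act_eq conj_by_Z)
  next
    fix u a b assume "u \<in> carrier (centralizer_group Q q)"
      "a \<in> carrier (coeff_group G N)" "b \<in> carrier (coeff_group G N)"
    then show "coeff_act G \<pi> u (a \<otimes>\<^bsub>coeff_group G N\<^esub> b)
             = coeff_act G \<pi> u a \<otimes>\<^bsub>coeff_group G N\<^esub> coeff_act G \<pi> u b"
      using lift[of u]
      by (auto simp: coeff_act_eq subgroup.m_closed[OF subgroup_Z] G.conj_by_mult Z_carrier)
  next
    fix u v a assume uv: "u \<in> carrier (centralizer_group Q q)" "v \<in> carrier (centralizer_group Q q)"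
      and a: "a \<in> carrier (coeff_group G N)"
    obtain g h where gh: "g \<in> carrier G" "\<pi> g = u" "h \<in> carrier G" "\<pi> h = v"
      using uv lift[of u] lift[of v] by auto
    then show "coeff_act G \<pi> (u \<otimes>\<^bsub>centralizer_group Q q\<^esub> v) a = coeff_act G \<pi> u (coeff_act G \<pi> v a)"
      using a coeff_act_eq[of "g \<otimes>\<^bsub>G\<^esub> h" a] coeff_act_eq[of h a]
        coeff_act_eq[of g "conj_by G h a"]
      by (simp add: G.conj_by_conj_by Z_carrier conj_by_Z)
  qed
qed

text \<open>With \<open>c = s(q) k\<^sup>-\<^sup>1\<close>, which centralizes the kernel group, the cocycle is
  \<open>u \<mapsto> s(u) c\<^sup>-\<^sup>1 s(u)\<^sup>-\<^sup>1 c\<close>.\<close>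

definition comm_with :: "'g \<Rightarrow> 'g \<Rightarrow> 'g" where
  "comm_with c g = conj_by G g (inv\<^bsub>G\<^esub> c) \<otimes>\<^bsub>G\<^esub> c"

lemma ext_cocycle_eq:
  assumes s: "set_section G Q \<pi> s" and q: "q \<in> carrier Q" and k: "implements_conj G N (s q) k"
  defines "c \<equiv> s q \<otimes>\<^bsub>G\<^esub> inv\<^bsub>G\<^esub> k"
  shows "centralizes c" "\<pi> c = q"
    "ext_cocycle G Q s q k = (\<lambda>u\<in>centralizer Q q. comm_with c (s u))"
proof -
  have sq: "s q \<in> carrier G" "\<pi> (s q) = q" and kN: "k \<in> N"
    using s q k by (auto simp: set_section_def implements_conj_def)
  have kc: "k \<in> carrier G" "\<pi> k = \<one>\<^bsub>Q\<^esub>" using kN N.mem_carrier N_D by auto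
  show "\<pi> c = q" using sq kc q by (simp add: c_def)
  have "conj_by G c x = x" if x: "x \<in> N" for x
  proof -
    have "conj_by G (inv\<^bsub>G\<^esub> k) x \<in> N" using x kc by (simp add: N.conj_by_in)
    then have "conj_by G (s q) (conj_by G (inv\<^bsub>G\<^esub> k) x) = conj_by G k (conj_by G (inv\<^bsub>G\<^esub> k) x)"
      using k by (simp add: implements_conj_def)
    then show ?thesis
      using x kc sq N.mem_carrier by (simp add: c_def G.conj_by_conj_by)
  qed
  then show cent: "centralizes c" using sq kc by (simp add: centralizes_def c_def)
  have "c \<otimes>\<^bsub>G\<^esub> k = k \<otimes>\<^bsub>G\<^esub> c" using cent kN by (rule centralizes_commute)
  moreover have "s q = c \<otimes>\<^bsub>G\<^esub> k" using sq kc by (simp add: c_def G.m_assoc)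
  ultimately have sq': "s q = k \<otimes>\<^bsub>G\<^esub> c" by simp
  have cc: "c \<in> carrier G" using cent by (simp add: centralizes_def)
  have "inv\<^bsub>G\<^esub> (ext_delta G s q u) \<otimes>\<^bsub>G\<^esub> inv\<^bsub>G\<^esub> k \<otimes>\<^bsub>G\<^esub> conj_by G (s u) k = comm_with c (s u)"
    if "u \<in> centralizer Q q" for u
  proof -
    have u: "s u \<in> carrier G" using that s by (auto simp: centralizer_def set_section_def)
    define e where "e = conj_by G (inv\<^bsub>G\<^esub> (s u)) c"
    have e: "e \<in> carrier G" "centralizes e"
      using u cent cc by (auto simp: e_def intro: centralizes_conj)
    have ek: "e \<otimes>\<^bsub>G\<^esub> k = k \<otimes>\<^bsub>G\<^esub> e" using e(2) kN by (rule centralizes_commute)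
    have uc: "c \<otimes>\<^bsub>G\<^esub> s u = s u \<otimes>\<^bsub>G\<^esub> e"
      using u cc by (simp add: e_def conj_by_def G.m_assoc)
    have "inv\<^bsub>G\<^esub> (ext_delta G s q u) \<otimes>\<^bsub>G\<^esub> inv\<^bsub>G\<^esub> k \<otimes>\<^bsub>G\<^esub> conj_by G (s u) k
        = s u \<otimes>\<^bsub>G\<^esub> inv\<^bsub>G\<^esub> (s q) \<otimes>\<^bsub>G\<^esub> inv\<^bsub>G\<^esub> (s u) \<otimes>\<^bsub>G\<^esub> (c \<otimes>\<^bsub>G\<^esub> s u) \<otimes>\<^bsub>G\<^esub> k \<otimes>\<^bsub>G\<^esub> inv\<^bsub>G\<^esub> (s u)"
      using u kc cc sq
      by (simp add: ext_delta_def conj_by_def G.m_assoc G.inv_mult_group c_def)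
    also have "\<dots> = s u \<otimes>\<^bsub>G\<^esub> inv\<^bsub>G\<^esub> (s q) \<otimes>\<^bsub>G\<^esub> (e \<otimes>\<^bsub>G\<^esub> k) \<otimes>\<^bsub>G\<^esub> inv\<^bsub>G\<^esub> (s u)"
      unfolding uc using u kc e sq by (simp add: G.m_assoc)
    also have "\<dots> = s u \<otimes>\<^bsub>G\<^esub> inv\<^bsub>G\<^esub> c \<otimes>\<^bsub>G\<^esub> e \<otimes>\<^bsub>G\<^esub> inv\<^bsub>G\<^esub> (s u)"
      unfolding ek sq' using u kc e cc by (simp add: G.m_assoc G.inv_mult_group)
    also have "\<dots> = comm_with c (s u)"
      using u cc by (simp add: e_def comm_with_def conj_by_def G.m_assoc)
    finally show ?thesis .
  qed
  then show "ext_cocycle G Q s q k = (\<lambda>u\<in>centralizer Q q. comm_with c (s u))"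
    by (auto simp: ext_cocycle_def intro!: restrict_ext)
qed

lemma comm_with_Z:
  assumes c: "centralizes c" and g: "g \<in> carrier G" "\<pi> g \<otimes>\<^bsub>Q\<^esub> \<pi> c = \<pi> c \<otimes>\<^bsub>Q\<^esub> \<pi> g"
  shows "comm_with c g \<in> Z"
proof -
  have cc: "c \<in> carrier G" using c by (simp add: centralizes_def)
  have q: "\<pi> g \<in> carrier Q" "\<pi> c \<in> carrier Q" using g cc by auto
  have "\<pi> (comm_with c g) = \<pi> g \<otimes>\<^bsub>Q\<^esub> inv\<^bsub>Q\<^esub> (\<pi> c) \<otimes>\<^bsub>Q\<^esub> (inv\<^bsub>Q\<^esub> (\<pi> g) \<otimes>\<^bsub>Q\<^esub> \<pi> c)"
    using g(1) cc by (simp add: comm_with_def conj_by_def Q.m_assoc)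
  also have "inv\<^bsub>Q\<^esub> (\<pi> g) \<otimes>\<^bsub>Q\<^esub> \<pi> c = \<pi> c \<otimes>\<^bsub>Q\<^esub> inv\<^bsub>Q\<^esub> (\<pi> g)"
    using subgroup.m_inv_closed[OF subgroup_centralizer[OF q(2)], of "\<pi> g"] q g(2)
    by (simp add: centralizer_def)
  finally have "comm_with c g \<in> N"
    using g(1) cc q by (intro N_I) (simp add: comm_with_def, simp add: Q.m_assoc)
  moreover have "centralizes (comm_with c g)"
    using c g(1) by (simp add: comm_with_def centralizes_mult centralizes_conj centralizes_inv)
  ultimately show ?thesis by (simp add: Z_iff)
qed

lemma comm_with_cong:
  assumes c: "centralizes c" and g: "g \<in> carrier G" "h \<in> carrier G" "\<pi> g = \<pi> h"
  shows "comm_with c g = comm_with c h"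
proof -
  from same_fibre(2)[OF g] obtain k where k: "k \<in> N" "g = h \<otimes>\<^bsub>G\<^esub> k" by blast
  have "centralizes (inv\<^bsub>G\<^esub> c)" using c by (rule centralizes_inv)
  then have "conj_by G k (inv\<^bsub>G\<^esub> c) = inv\<^bsub>G\<^esub> c"
    using centralizes_commute[of "inv\<^bsub>G\<^esub> c" k] k N.mem_carrier centralizes_closed
    by (intro G.conj_by_eq_self) auto
  moreover have "c \<in> carrier G" "k \<in> carrier G"
    using c k N.mem_carrier by (auto simp: centralizes_def)
  ultimately show ?thesis using k g by (simp add: comm_with_def G.conj_by_conj_by)
qed

lemma comm_with_mult:
  assumes c: "centralizes c"
    and g: "g \<in> carrier G" "\<pi> g \<otimes>\<^bsub>Q\<^esub> \<pi> c = \<pi> c \<otimes>\<^bsub>Q\<^esub> \<pi> g"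
    and h: "h \<in> carrier G" "\<pi> h \<otimes>\<^bsub>Q\<^esub> \<pi> c = \<pi> c \<otimes>\<^bsub>Q\<^esub> \<pi> h"
  shows "comm_with c (g \<otimes>\<^bsub>G\<^esub> h) = comm_with c g \<otimes>\<^bsub>G\<^esub> conj_by G g (comm_with c h)"
proof -
  have cc: "c \<in> carrier G" using c by (simp add: centralizes_def)
  have "comm_with c g \<otimes>\<^bsub>G\<^esub> conj_by G g (comm_with c h)
      = conj_by G g (comm_with c h) \<otimes>\<^bsub>G\<^esub> comm_with c g"
    by (intro Z_commute conj_by_Z comm_with_Z assms)
  also have "\<dots> = comm_with c (g \<otimes>\<^bsub>G\<^esub> h)"
    using g(1) h(1) cc
    by (simp add: comm_with_def conj_by_def G.m_assoc G.inv_mult_group)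
  finally show ?thesis ..
qed

theorem ext_cocycle_in:
  assumes s: "set_section G Q \<pi> s" and q: "q \<in> carrier Q" and k: "implements_conj G N (s q) k"
  shows "ext_cocycle G Q s q k
           \<in> carrier (cocycles1 (centralizer_group Q q) (coeff_group G N) (coeff_act G \<pi>))"
proof -
  define c where "c = s q \<otimes>\<^bsub>G\<^esub> inv\<^bsub>G\<^esub> k"
  note c = ext_cocycle_eq[OF s q k, folded c_def]
  have s': "s u \<in> carrier G" "\<pi> (s u) = u" "u \<otimes>\<^bsub>Q\<^esub> q = q \<otimes>\<^bsub>Q\<^esub> u"
    if "u \<in> centralizer Q q" for u
    using that s by (auto simp: centralizer_def set_section_def)
  have Z: "comm_with c (s u) \<in> Z" if "u \<in> centralizer Q q" for u
    using comm_with_Z[OF c(1), of "s u"] s'[OF that] c(2) by simp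
  have "comm_with c (s (u \<otimes>\<^bsub>Q\<^esub> v)) = comm_with c (s u) \<otimes>\<^bsub>G\<^esub> coeff_act G \<pi> u (comm_with c (s v))"
    if u: "u \<in> centralizer Q q" and v: "v \<in> centralizer Q q" for u v
  proof -
    have uv: "u \<otimes>\<^bsub>Q\<^esub> v \<in> centralizer Q q"
      using u v by (rule subgroup.m_closed[OF subgroup_centralizer[OF q]])
    have "comm_with c (s (u \<otimes>\<^bsub>Q\<^esub> v)) = comm_with c (s u \<otimes>\<^bsub>G\<^esub> s v)"
      using s'[OF u] s'[OF v] s'[OF uv] by (intro comm_with_cong[OF c(1)]) auto
    also have "\<dots> = comm_with c (s u) \<otimes>\<^bsub>G\<^esub> conj_by G (s u) (comm_with c (s v))"
      using s'[OF u] s'[OF v] c(2) by (intro comm_with_mult[OF c(1)]) auto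
    finally show ?thesis
      using coeff_act_eq[of "s u" "comm_with c (s v)"] s'[OF u] Z[OF v] by simp
  qed
  then show ?thesis
    using Z subgroup.m_closed[OF subgroup_centralizer[OF q]]
    by (auto simp: c(3) cocycles1_def)
qed

theorem ext_class_eq:
  assumes s: "set_section G Q \<pi> s" and q: "q \<in> carrier Q" and k: "implements_conj G N (s q) k"
  shows "ext_class G N Q \<pi> q =
     coboundaries1 (centralizer_group Q q) (coeff_group G N) (coeff_act G \<pi>)
       #>\<^bsub>cocycles1 (centralizer_group Q q) (coeff_group G N) (coeff_act G \<pi>)\<^esub> ext_cocycle G Q s q k"
    (is "_ = ?B #>\<^bsub>?Z1\<^esub> _")
  unfolding ext_class_def
proof (rule the_equality)
  show "\<exists>t l. set_section G Q \<pi> t \<and> implements_conj G N (t q) l \<and>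
      ?B #>\<^bsub>?Z1\<^esub> ext_cocycle G Q s q k = ?B #>\<^bsub>?Z1\<^esub> ext_cocycle G Q t q l"
    using s k by blast
next
  interpret M: group_module "centralizer_group Q q" "coeff_group G N" "coeff_act G \<pi>"
    by (rule group_module_centralizer[OF q])
  fix C assume "\<exists>t l. set_section G Q \<pi> t \<and> implements_conj G N (t q) l \<and>
      C = ?B #>\<^bsub>?Z1\<^esub> ext_cocycle G Q t q l"
  then obtain t l where t: "set_section G Q \<pi> t" and l: "implements_conj G N (t q) l"
    and C: "C = ?B #>\<^bsub>?Z1\<^esub> ext_cocycle G Q t q l" by blast
  define c where "c = s q \<otimes>\<^bsub>G\<^esub> inv\<^bsub>G\<^esub> k"
  define d where "d = t q \<otimes>\<^bsub>G\<^esub> inv\<^bsub>G\<^esub> l"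
  note c = ext_cocycle_eq[OF s q k, folded c_def]
  note d = ext_cocycle_eq[OF t q l, folded d_def]
  have cc: "c \<in> carrier G" "d \<in> carrier G" using c(1) d(1) by (auto simp: centralizes_def)
  define z where "z = inv\<^bsub>G\<^esub> d \<otimes>\<^bsub>G\<^esub> c"
  have "z \<in> N" using cc c(2) d(2) q by (intro N_I) (simp_all add: z_def)
  moreover have "centralizes z"
    unfolding z_def by (intro centralizes_mult centralizes_inv c d)
  ultimately have z: "z \<in> Z" by (simp add: Z_iff)
  have "comm_with d (t u) = inv\<^bsub>G\<^esub> z \<otimes>\<^bsub>G\<^esub> coeff_act G \<pi> u z \<otimes>\<^bsub>G\<^esub> comm_with c (s u)"
    if u: "u \<in> centralizer Q q" for u
  proof -
    have su: "s u \<in> carrier G" "t u \<in> carrier G" "\<pi> (s u) = u" "\<pi> (t u) = u"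
      and uq: "u \<otimes>\<^bsub>Q\<^esub> q = q \<otimes>\<^bsub>Q\<^esub> u"
      using u s t by (auto simp: centralizer_def set_section_def)
    have "comm_with d (t u) = comm_with d (s u)"
      using su by (intro comm_with_cong[OF d(1)]) auto
    also have "\<dots> = conj_by G (s u) z \<otimes>\<^bsub>G\<^esub> comm_with c (s u) \<otimes>\<^bsub>G\<^esub> inv\<^bsub>G\<^esub> z"
      using su cc by (simp add: comm_with_def conj_by_def z_def G.m_assoc G.inv_mult_group)
    also have "\<dots> = inv\<^bsub>G\<^esub> z \<otimes>\<^bsub>G\<^esub> (conj_by G (s u) z \<otimes>\<^bsub>G\<^esub> comm_with c (s u))"
      using su uq c(2) z
      by (intro Z_commute subgroup.m_closed[OF subgroup_Z] subgroup.m_inv_closed[OF subgroup_Z]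
            conj_by_Z comm_with_Z[OF c(1)]) auto
    finally show ?thesis
      using su z cc coeff_act_eq[of "s u" z] Z_carrier[OF z]
      by (simp add: G.m_assoc comm_with_def)
  qed
  then have "ext_cocycle G Q t q l =
      (\<lambda>u\<in>centralizer Q q. inv\<^bsub>G\<^esub> z \<otimes>\<^bsub>G\<^esub> coeff_act G \<pi> u z) \<otimes>\<^bsub>?Z1\<^esub> ext_cocycle G Q s q k"
    by (auto simp: c(3) d(3) cocycles1_def intro!: restrict_ext)
  moreover have "(\<lambda>u\<in>centralizer Q q. inv\<^bsub>G\<^esub> z \<otimes>\<^bsub>G\<^esub> coeff_act G \<pi> u z) \<in> ?B"
    using z by (auto simp: coboundaries1_def inv_coeff[symmetric] intro!: exI[of _ z])
  ultimately have "ext_cocycle G Q t q l \<in> ?B #>\<^bsub>?Z1\<^esub> ext_cocycle G Q s q k"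
    by (auto simp: r_coset_def)
  then show "C = ?B #>\<^bsub>?Z1\<^esub> ext_cocycle G Q s q k"
    using group.repr_independence[OF comm_group.axioms(2)[OF M.comm_group_cocycles1] _
        ext_cocycle_in[OF s q k] M.subgroup_coboundaries1] C
    by simp
qed

text \<open>On the kernel of the coupling the choices of section and conjugating element exist.\<close>

theorem ext_choices_exist:
  assumes q: "q \<in> carrier Q" and ker: "coupling G N \<pi> q = \<one>\<^bsub>Out (G\<lparr>carrier := N\<rparr>)\<^esub>"
  shows "\<exists>s k. set_section G Q \<pi> s \<and> implements_conj G N (s q) k"
proof -
  obtain s where s: "set_section G Q \<pi> s"
    using lift_exists unfolding set_section_def by metis
  then have "s q \<in> carrier G" "\<pi> (s q) = q" using q by (auto simp: set_section_def)
  then show ?thesis using coupling_one_iff[of "s q"] ker s by auto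
qed

end

sublocale group_extension \<subseteq> ker: kernel_extension G Q \<pi> "\<iota> ` carrier K"
  using surj exact by unfold_locales auto

end

theory Submission
  imports Defs
begin

text \<open>An element \<open>q\<close> of \<open>ker \<Theta>\<close> has \<open>[q] = 0\<close> exactly when it lifts to some \<open>d \<in> G\<close> that commutes
  with the whole preimage of \<open>C(q)\<close>: replacing a lift \<open>c\<close> centralizing \<open>K\<close> by \<open>c z\<close> with
  \<open>z \<in> Z\<close> changes the cocycle by a coboundary.  For such a lift, \<open>\<pi>\<close> is injective on the conjugacy
  class of \<open>d\<close>, so \<open>d\<close> has a finite class if \<open>q\<close> does.  Conversely, if \<open>g\<close> has a finite class and
  \<open>FC_G(K) = {1}\<close>, then every commutator of \<open>g\<close> with the preimage of \<open>C(\<pi> g)\<close> lies in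
  \<open>K \<inter> FC(G) = {1}\<close>.\<close>

section \<open>Elements with finite conjugacy class, in an arbitrary group\<close>

lemma FC_iff: "x \<in> FC G \<longleftrightarrow> x \<in> carrier G \<and> finite (conj_class G x)"
  by (simp add: FC_def FC_in_def)

context group
begin

lemma conj_class_one: "conj_class G \<one> = {\<one>}"
proof -
  have "conj_by G y \<one> = \<one>" if "y \<in> carrier G" for y
    using that by (simp add: conj_by_def)
  then have "conj_class G \<one> = (\<lambda>_. \<one>) ` carrier G"
    unfolding conj_class_def Setcompr_eq_image by (intro image_cong) auto
  also have "\<dots> = {\<one>}"
    using one_closed by (intro image_constant)
  finally show ?thesis .
qed

lemma FC_one: "\<one> \<in> FC G"
  by (simp add: FC_iff conj_class_one)

text \<open>Every conjugate of a product is a product of conjugates, so finitely many arise. With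
  \<open>FC_inv\<close> and \<open>FC_conj\<close> this puts the commutator of an element of
  \<open>FC G\<close> with any group element back into \<open>FC G\<close>.\<close>

lemma FC_mult:
  assumes "x \<in> FC G" "y \<in> FC G"
  shows "x \<otimes> y \<in> FC G"
proof -
  have "conj_class G (x \<otimes> y) \<subseteq> (\<lambda>(a, b). a \<otimes> b) ` (conj_class G x \<times> conj_class G y)"
    using assms by (fastforce simp: conj_class_def FC_iff conj_by_mult)
  moreover have "finite ((\<lambda>(a, b). a \<otimes> b) ` (conj_class G x \<times> conj_class G y))"
    using assms by (simp add: FC_iff)
  ultimately show ?thesis
    using assms by (simp add: FC_iff finite_subset)
qed

lemma FC_inv:
  assumes "x \<in> FC G"
  shows "inv x \<in> FC G"
proof -
  have "conj_class G (inv x) \<subseteq> m_inv G ` conj_class G x"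
    using assms by (auto simp: conj_class_def FC_iff conj_by_inv)
  then show ?thesis
    using assms by (auto simp: FC_iff intro: finite_subset)
qed

lemma FC_conj:
  assumes "x \<in> FC G" "g \<in> carrier G"
  shows "conj_by G g x \<in> FC G"
proof -
  have "conj_by G y (conj_by G g x) \<in> conj_class G x" if "y \<in> carrier G" for y
    using that assms conj_by_conj_by[of y g x, symmetric]
    by (auto simp: conj_class_def FC_iff)
  then have "conj_class G (conj_by G g x) \<subseteq> conj_class G x"
    by (auto simp: conj_class_def[of G "conj_by G g x"])
  then show ?thesis
    using assms by (auto simp: FC_iff intro: finite_subset)
qed

lemma finite_carrier_FC:
  assumes "finite (carrier G)"
  shows "FC G = carrier G"
proof -
  have "conj_class G x \<subseteq> carrier G" if "x \<in> carrier G" for x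
    using that by (auto simp: conj_class_def)
  then have "finite (conj_class G x)" if "x \<in> carrier G" for x
    using that assms by (blast intro: finite_subset)
  then show ?thesis
    by (auto simp: FC_iff)
qed

text \<open>In a finite group all classes are finite, so \<open>FC G\<close> is the whole carrier. A
  nontrivial group with trivial \<open>FC G\<close> is therefore infinite, and the first clause of
  \<open>icc\<close> follows from the second.\<close>

lemma icc_iff_FC:
  assumes "carrier G \<noteq> {\<one>}"
  shows "icc G \<longleftrightarrow> FC G = {\<one>}"
proof -
  have "infinite (carrier G)" if "FC G = {\<one>}"
    using that assms finite_carrier_FC by metis
  moreover have "FC G = {\<one>} \<longleftrightarrow> (\<forall>x\<in>carrier G. x \<noteq> \<one> \<longrightarrow> infinite (conj_class G x))"
    using FC_one FC_iff[of _ G] by blast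
  ultimately show ?thesis
    unfolding icc_def by blast
qed

end

section \<open>Finite conjugacy classes under the projection to the quotient\<close>

context kernel_extension
begin

text \<open>Surjectivity of \<open>\<pi>\<close> lifts each conjugating element of \<open>Q\<close>
  to \<open>G\<close>, so the class of \<open>\<pi> g\<close> is covered by the image of the class
  of \<open>g\<close>.\<close>

lemma FC_image:
  assumes "g \<in> FC G"
  shows "\<pi> g \<in> FC Q"
proof -
  have "conj_class Q (\<pi> g) \<subseteq> \<pi> ` conj_class G g"
  proof
    fix x assume "x \<in> conj_class Q (\<pi> g)"
    then obtain u where u: "u \<in> carrier Q" "x = conj_by Q u (\<pi> g)"
      by (auto simp: conj_class_def)
    then obtain h where "h \<in> carrier G" "\<pi> h = u"
      using lift_exists by blast
    with u assms have "x = \<pi> (conj_by G h g)" "conj_by G h g \<in> conj_class G g"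
      by (auto simp: conj_by_def conj_class_def FC_iff)
    then show "x \<in> \<pi> ` conj_class G g" by blast
  qed
  then show ?thesis
    using assms by (auto simp: FC_iff intro: finite_subset)
qed

lemma FC_lift:
  assumes d: "d \<in> carrier G" and q: "\<pi> d \<in> FC Q"
    and comm: "\<And>g. \<lbrakk>g \<in> carrier G; \<pi> g \<in> centralizer Q (\<pi> d)\<rbrakk> \<Longrightarrow> conj_by G g d = d"
  shows "d \<in> FC G"
proof -
  have "\<pi> ` conj_class G d \<subseteq> conj_class Q (\<pi> d)"
    using d by (auto simp: conj_class_def conj_by_def)
  then have "finite (\<pi> ` conj_class G d)"
    using q by (auto simp: FC_iff intro: finite_subset)
  moreover have "inj_on \<pi> (conj_class G d)"
  proof (rule inj_onI)
    fix x y assume "x \<in> conj_class G d" "y \<in> conj_class G d" and eq: "\<pi> x = \<pi> y"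
    then obtain a b where a: "a \<in> carrier G" "x = conj_by G a d"
      and b: "b \<in> carrier G" "y = conj_by G b d"
      by (auto simp: conj_class_def)
    \<comment> \<open>If the conjugates of \<open>d\<close> by \<open>a\<close> and \<open>b\<close>
      have the same image, this element maps into the centralizer of \<open>\<pi> d\<close>. By
      \<open>comm\<close> it fixes \<open>d\<close>, so the two conjugates agree.\<close>
    let ?g = "inv\<^bsub>G\<^esub> b \<otimes>\<^bsub>G\<^esub> a"
    have eq': "conj_by Q (\<pi> a) (\<pi> d) = conj_by Q (\<pi> b) (\<pi> d)"
      using eq a b d by (simp add: conj_by_def)
    have "conj_by Q (\<pi> ?g) (\<pi> d) = conj_by Q (inv\<^bsub>Q\<^esub> (\<pi> b)) (conj_by Q (\<pi> a) (\<pi> d))"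
      using a b d by (simp add: Q.conj_by_conj_by)
    also have "\<dots> = \<pi> d"
      using b d by (simp add: eq')
    finally have "\<pi> ?g \<otimes>\<^bsub>Q\<^esub> \<pi> d \<otimes>\<^bsub>Q\<^esub> inv\<^bsub>Q\<^esub> (\<pi> ?g) = \<pi> d"
      by (simp only: conj_by_def)
    moreover have "\<pi> ?g \<in> carrier Q" "\<pi> d \<in> carrier Q"
      using a b d by auto
    ultimately have "\<pi> ?g \<in> centralizer Q (\<pi> d)"
      unfolding centralizer_def
      by (metis (mono_tags, lifting) Q.inv_solve_right' Q.m_closed mem_Collect_eq)
    then have "conj_by G ?g d = d"
      using a b by (intro comm) auto
    then have "conj_by G b d = conj_by G b (conj_by G ?g d)"
      by simp
    also have "\<dots> = conj_by G a d"
      using a b d by (simp flip: G.conj_by_conj_by)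
    finally show "x = y"
      using a b by simp
  qed
  ultimately show ?thesis
    using d by (simp add: FC_iff finite_image_iff)
qed

section \<open>Vanishing of the class [q] and lifts commuting with the preimage of C(q)\<close>

lemma ext_class_zero_iff:
  assumes s: "set_section G Q \<pi> s" and q: "q \<in> carrier Q" and k: "implements_conj G N (s q) k"
  shows "ext_class G N Q \<pi> q = \<one>\<^bsub>H1_centralizer G N Q \<pi> q\<^esub> \<longleftrightarrow>
    ext_cocycle G Q s q k
      \<in> coboundaries1 (centralizer_group Q q) (coeff_group G N) (coeff_act G \<pi>)"
proof -
  interpret M: group_module "centralizer_group Q q" "coeff_group G N" "coeff_act G \<pi>"
    by (rule group_module_centralizer[OF q])
  interpret Z1: comm_group "cocycles1 (centralizer_group Q q) (coeff_group G N) (coeff_act G \<pi>)"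
    by (rule M.comm_group_cocycles1)
  show ?thesis
    \<comment> \<open>\<open>ext_class\<close> is the coset of the coboundaries through the cocycle;
      a coset is the unit of the quotient exactly when its representative lies in the
      subgroup.\<close>
    using Z1.coset_join1[OF _ ext_cocycle_in[OF s q k] M.subgroup_coboundaries1]
      Z1.coset_join2[OF ext_cocycle_in[OF s q k] M.subgroup_coboundaries1]
    by (auto simp: ext_class_eq[OF s q k] H1_def)
qed

lemma comm_with_eq_one_iff:
  assumes "c \<in> carrier G" "g \<in> carrier G"
  shows "comm_with c g = \<one>\<^bsub>G\<^esub> \<longleftrightarrow> conj_by G g c = c"
proof -
  have "comm_with c g = inv\<^bsub>G\<^esub> (conj_by G g c) \<otimes>\<^bsub>G\<^esub> c"
    using assms by (simp add: comm_with_def G.conj_by_inv)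
  then show ?thesis
    using assms G.inv_solve_left'[of "\<one>\<^bsub>G\<^esub>" "conj_by G g c" c] by auto
qed

lemma ext_class_zero_lift:
  assumes q: "q \<in> carrier Q" and ker: "coupling G N \<pi> q = \<one>\<^bsub>Out (G\<lparr>carrier := N\<rparr>)\<^esub>"
    and zero: "ext_class G N Q \<pi> q = \<one>\<^bsub>H1_centralizer G N Q \<pi> q\<^esub>"
  obtains d where "d \<in> carrier G" "\<pi> d = q"
    "\<And>g. \<lbrakk>g \<in> carrier G; \<pi> g \<in> centralizer Q q\<rbrakk> \<Longrightarrow> conj_by G g d = d"
proof -
  obtain s k where s: "set_section G Q \<pi> s" and k: "implements_conj G N (s q) k"
    using ext_choices_exist[OF q ker] by blast
  define c where "c = s q \<otimes>\<^bsub>G\<^esub> inv\<^bsub>G\<^esub> k"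
  note c = ext_cocycle_eq[OF s q k, folded c_def]
  have cc: "c \<in> carrier G" using c(1) by (rule centralizes_closed)
  obtain z where z: "z \<in> Z" and
    cob: "ext_cocycle G Q s q k
      = (\<lambda>u\<in>centralizer Q q. inv\<^bsub>coeff_group G N\<^esub> z \<otimes>\<^bsub>G\<^esub> coeff_act G \<pi> u z)"
    using zero unfolding ext_class_zero_iff[OF s q k] coboundaries1_def by auto
  have zc: "z \<in> carrier G" "centralizes z" "\<pi> z = \<one>\<^bsub>Q\<^esub>"
    using z Z_carrier N_D by (auto simp: Z_iff)
  \<comment> \<open>The lift \<open>c\<close> is corrected by the \<open>z\<close> whose coboundary
    is the cocycle: the factors that \<open>z\<close> adds to \<open>comm_with c g\<close> cancel
    that coboundary.\<close>
  let ?d = "c \<otimes>\<^bsub>G\<^esub> z"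
  have "conj_by G g ?d = ?d" if g: "g \<in> carrier G" and gq: "\<pi> g \<in> centralizer Q q" for g
  proof -
    have sg: "s (\<pi> g) \<in> carrier G" "\<pi> (s (\<pi> g)) = \<pi> g"
      using s g by (auto simp: set_section_def)
    \<comment> \<open>The cocycle gives values only at section elements, but
      \<open>comm_with c\<close> depends only on the image in \<open>Q\<close>, because
      \<open>c\<close> centralizes \<open>N\<close>.\<close>
    have "comm_with c g = comm_with c (s (\<pi> g))"
      using g sg by (intro comm_with_cong[OF c(1)]) auto
    also have "\<dots> = inv\<^bsub>G\<^esub> z \<otimes>\<^bsub>G\<^esub> conj_by G g z"
      using c(3) cob gq coeff_act_eq[OF g z] inv_coeff[OF z] by (metis restrict_apply')
    finally have cg: "comm_with c g = inv\<^bsub>G\<^esub> z \<otimes>\<^bsub>G\<^esub> conj_by G g z" .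
    have "comm_with ?d g = inv\<^bsub>G\<^esub> (conj_by G g z) \<otimes>\<^bsub>G\<^esub> comm_with c g \<otimes>\<^bsub>G\<^esub> z"
      using g cc zc
      by (simp add: comm_with_def G.conj_by_mult G.conj_by_inv G.inv_mult_group G.m_assoc)
    \<comment> \<open>\<open>inv z\<close> and the conjugate of \<open>z\<close> both lie in the
      abelian group \<open>Z\<close>; once they are swapped, everything cancels.\<close>
    also have "\<dots> = inv\<^bsub>G\<^esub> (conj_by G g z) \<otimes>\<^bsub>G\<^esub> (conj_by G g z \<otimes>\<^bsub>G\<^esub> inv\<^bsub>G\<^esub> z) \<otimes>\<^bsub>G\<^esub> z"
      unfolding cg using Z_commute[OF subgroup.m_inv_closed[OF subgroup_Z z] conj_by_Z[OF g z]]
      by simp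
    also have "\<dots> = \<one>\<^bsub>G\<^esub>"
      using g zc by (simp add: G.m_assoc)
    finally show ?thesis
      using comm_with_eq_one_iff g cc zc by simp
  qed
  moreover have "?d \<in> carrier G" "\<pi> ?d = q"
    using cc zc c(2) q by auto
  ultimately show ?thesis using that by blast
qed

text \<open>Since the class does not depend on the choices, it may be computed with a section
  through \<open>d\<close> itself and conjugating element one. The cocycle is then identically
  one.\<close>

lemma commuting_lift_ext_class_zero:
  assumes d: "centralizes d"
    and comm: "\<And>g. \<lbrakk>g \<in> carrier G; \<pi> g \<in> centralizer Q (\<pi> d)\<rbrakk> \<Longrightarrow> conj_by G g d = d"
  shows "coupling G N \<pi> (\<pi> d) = \<one>\<^bsub>Out (G\<lparr>carrier := N\<rparr>)\<^esub>"
    and "ext_class G N Q \<pi> (\<pi> d) = \<one>\<^bsub>H1_centralizer G N Q \<pi> (\<pi> d)\<^esub>"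
proof -
  have dc: "d \<in> carrier G" and q: "\<pi> d \<in> carrier Q"
    using centralizes_closed[OF d] by auto
  have impl: "implements_conj G N d \<one>\<^bsub>G\<^esub>"
    using d N.mem_carrier by (auto simp: implements_conj_def centralizes_def N.one_closed)
  then show "coupling G N \<pi> (\<pi> d) = \<one>\<^bsub>Out (G\<lparr>carrier := N\<rparr>)\<^esub>"
    using coupling_one_iff[OF dc] by blast
  obtain s0 where "set_section G Q \<pi> s0"
    using lift_exists unfolding set_section_def by metis
  then have s: "set_section G Q \<pi> (s0(\<pi> d := d))"
    using dc by (simp add: set_section_def)
  have k: "implements_conj G N ((s0(\<pi> d := d)) (\<pi> d)) \<one>\<^bsub>G\<^esub>"
    using impl by simp
  define s where "s = s0(\<pi> d := d)"
  note s = s[folded s_def] and k = k[folded s_def]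
  interpret M: group_module "centralizer_group Q (\<pi> d)" "coeff_group G N" "coeff_act G \<pi>"
    by (rule group_module_centralizer[OF q])
  have "comm_with d (s u) = \<one>\<^bsub>G\<^esub>" if "u \<in> centralizer Q (\<pi> d)" for u
    using that s dc comm[of "s u"] comm_with_eq_one_iff[of d "s u"]
    by (auto simp: set_section_def centralizer_def)
  \<comment> \<open>This is the centralizing element of \<open>ext_cocycle_eq\<close> for the
    present choices, so the cocycle sends \<open>u\<close> to
    \<open>comm_with d (s u)\<close>.\<close>
  moreover have "s (\<pi> d) \<otimes>\<^bsub>G\<^esub> inv\<^bsub>G\<^esub> \<one>\<^bsub>G\<^esub> = d"
    using dc by (simp add: s_def)
  ultimately have "ext_cocycle G Q s (\<pi> d) \<one>\<^bsub>G\<^esub> = (\<lambda>u\<in>centralizer Q (\<pi> d). \<one>\<^bsub>G\<^esub>)"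
    unfolding ext_cocycle_eq(3)[OF s q k] by (intro restrict_ext) simp
  then have "ext_cocycle G Q s (\<pi> d) \<one>\<^bsub>G\<^esub>
      = \<one>\<^bsub>cocycles1 (centralizer_group Q (\<pi> d)) (coeff_group G N) (coeff_act G \<pi>)\<^esub>"
    by (simp add: cocycles1_def coeff_group_def)
  then show "ext_class G N Q \<pi> (\<pi> d) = \<one>\<^bsub>H1_centralizer G N Q \<pi> (\<pi> d)\<^esub>"
    using subgroup.one_closed[OF M.subgroup_coboundaries1]
    by (simp add: ext_class_zero_iff[OF s q k])
qed

section \<open>Elements of FC(G) when \<open>FC_in G N\<close> is trivial\<close>

lemma FC_commutes:
  assumes FC: "FC_in G N = {\<one>\<^bsub>G\<^esub>}" and d: "d \<in> FC G"
    and g: "g \<in> carrier G" "\<pi> g \<in> centralizer Q (\<pi> d)"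
  shows "conj_by G g d = d"
proof -
  have dc: "d \<in> carrier G" using d by (simp add: FC_iff)
  have e: "\<pi> g \<otimes>\<^bsub>Q\<^esub> \<pi> d = \<pi> d \<otimes>\<^bsub>Q\<^esub> \<pi> g"
    using g(2) by (simp add: centralizer_def)
  have "conj_by G g d \<otimes>\<^bsub>G\<^esub> inv\<^bsub>G\<^esub> d \<in> FC G"
    using d g(1) by (intro G.FC_mult G.FC_conj G.FC_inv)
  moreover have "conj_by G g d \<otimes>\<^bsub>G\<^esub> inv\<^bsub>G\<^esub> d \<in> N"
    using dc g(1) e by (intro N_I) (simp_all add: conj_by_def, simp add: Q.m_assoc)
  ultimately have "conj_by G g d \<otimes>\<^bsub>G\<^esub> inv\<^bsub>G\<^esub> d = \<one>\<^bsub>G\<^esub>"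
    using FC by (auto simp: FC_in_def FC_iff)
  then show ?thesis
    using dc g(1) G.inv_solve_right'[of "\<one>\<^bsub>G\<^esub>" "conj_by G g d" d] by auto
qed

text \<open>An element of \<open>N\<close> maps to one, which centralizes \<open>\<pi> d\<close>, so
  \<open>FC_commutes\<close> applies to conjugation by it.\<close>

lemma FC_centralizes:
  assumes FC: "FC_in G N = {\<one>\<^bsub>G\<^esub>}" and d: "d \<in> FC G"
  shows "centralizes d"
proof -
  have dc: "d \<in> carrier G" using d by (simp add: FC_iff)
  have "conj_by G d x = x" if x: "x \<in> N" for x
  proof -
    have xc: "x \<in> carrier G" and "\<pi> x \<in> centralizer Q (\<pi> d)"
      using x dc N.mem_carrier N_D by (auto simp: centralizer_def)
    then have "conj_by G x d = d"
      by (rule FC_commutes[OF FC d])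
    then show ?thesis
      using conj_by_eq_iff[OF xc dc] conj_by_eq_iff[OF dc xc] by simp
  qed
  then show ?thesis
    using dc by (simp add: centralizes_def)
qed

section \<open>The icc criterion for extensions\<close>

theorem icc_iff:
  assumes "carrier G \<noteq> {\<one>\<^bsub>G\<^esub>}"
  shows "icc G \<longleftrightarrow> FC_in G N = {\<one>\<^bsub>G\<^esub>} \<and>
    \<not> (\<exists>q\<in>FC Q. coupling G N \<pi> q = \<one>\<^bsub>Out (G\<lparr>carrier := N\<rparr>)\<^esub> \<and> q \<noteq> \<one>\<^bsub>Q\<^esub> \<and>
         ext_class G N Q \<pi> q = \<one>\<^bsub>H1_centralizer G N Q \<pi> q\<^esub>)"
    (is "_ \<longleftrightarrow> ?i \<and> \<not> ?ii")
proof
  assume "icc G"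
  then have FC: "FC G = {\<one>\<^bsub>G\<^esub>}" by (simp add: G.icc_iff_FC[OF assms])
  have "FC_in G N = N \<inter> FC G"
    using N.mem_carrier by (auto simp: FC_in_def FC_iff)
  then have ?i using FC N.one_closed by auto
  moreover have "q = \<one>\<^bsub>Q\<^esub>"
    if q: "q \<in> FC Q" and ker: "coupling G N \<pi> q = \<one>\<^bsub>Out (G\<lparr>carrier := N\<rparr>)\<^esub>"
      and zero: "ext_class G N Q \<pi> q = \<one>\<^bsub>H1_centralizer G N Q \<pi> q\<^esub>" for q
  proof -
    have "q \<in> carrier Q" using q by (simp add: FC_iff)
    from ext_class_zero_lift[OF this ker zero] obtain d
      where d: "d \<in> carrier G" "\<pi> d = q"
        "\<And>g. \<lbrakk>g \<in> carrier G; \<pi> g \<in> centralizer Q q\<rbrakk> \<Longrightarrow> conj_by G g d = d" by blast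
    then have "d \<in> FC G" using q by (intro FC_lift) auto
    then show ?thesis using FC d(2) by auto
  qed
  ultimately show "?i \<and> \<not> ?ii" by blast
next
  assume asm: "?i \<and> \<not> ?ii"
  have "d = \<one>\<^bsub>G\<^esub>" if d: "d \<in> FC G" for d
  proof -
    \<comment> \<open>Here \<open>d\<close> is itself a commuting lift of \<open>\<pi> d\<close>, so
      the coupling and the class of \<open>\<pi> d\<close> are trivial. As \<open>\<pi> d\<close>
      lies in \<open>FC Q\<close>, condition (ii) makes it one; then \<open>d\<close> lies in
      \<open>N\<close> and condition (i) gives \<open>d = \<one>\<close>.\<close>
    note z = commuting_lift_ext_class_zero[OF FC_centralizes FC_commutes, OF _ d _ d]
    have "\<pi> d = \<one>\<^bsub>Q\<^esub>"
      using asm FC_image[OF d] z by blast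
    then have "d \<in> FC_in G N"
      using d N_I by (auto simp: FC_in_def FC_iff)
    then show ?thesis using asm by simp
  qed
  then have "FC G = {\<one>\<^bsub>G\<^esub>}"
    using G.FC_one by blast
  then show "icc G"
    by (simp add: G.icc_iff_FC[OF assms])
qed

end

theorem theorem2p3:
  fixes K\<^sub>0 :: "('k, 'l) monoid_scheme" and G :: "('g, 'm) monoid_scheme"
    and Q :: "('q, 'n) monoid_scheme" and \<iota> :: "'k \<Rightarrow> 'g" and \<pi> :: "'g \<Rightarrow> 'q"
    and K :: "'g set" and \<Theta> \<Phi> :: "'q \<Rightarrow> ('g \<Rightarrow> 'g) set"
  assumes "group_extension K\<^sub>0 G Q \<iota> \<pi>"
    and "K = \<iota> ` carrier K\<^sub>0"
    and "carrier G \<noteq> {\<one>\<^bsub>G\<^esub>}"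
    and "\<Theta> = coupling G K \<pi>"
    and "\<Phi> = restrict \<Theta> (FC Q)"
  shows "icc G \<longleftrightarrow>
           FC_in G K = {\<one>\<^bsub>G\<^esub>} \<and>
           \<not> (\<exists>q\<in>kernel (Q\<lparr>carrier := FC Q\<rparr>) (Out (G\<lparr>carrier := K\<rparr>)) \<Phi>.
                q \<noteq> \<one>\<^bsub>Q\<^esub> \<and> ext_class G K Q \<pi> q = \<one>\<^bsub>H1_centralizer G K Q \<pi> q\<^esub>)"
proof -
  interpret group_extension K\<^sub>0 G Q \<iota> \<pi> by fact
  show ?thesis
    \<comment> \<open>Restricting to \<open>FC Q\<close> makes the kernel of \<open>\<Phi>\<close>
      the set of \<open>q\<close> in \<open>FC Q\<close> with trivial coupling, the form used in
      \<open>icc_iff\<close>.\<close>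
    using ker.icc_iff[folded assms(2), OF assms(3)] assms(4,5) by (auto simp: kernel_def)
qed

end
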